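(* Let $q$ be a prime power, let $0\leqslant j\leqslant q-2$ and let $n$ be an integer with $2\leqslant n\leqslant j+1$. Then the matrix $M(j,n,q,t)$ is diagonalizable over $\mathbb{C}_\infty$ if and only if $q$ is odd.
   Context: Let $q$ be a power of a prime $p$, and let $\mathbb{C}_\infty$ be the completion of an algebraic closure of $\mathbb{F}_q((1/t))$. For integers $0\leqslant j\leqslant q-2$ and $n\geqslant 1$, $M(j,n,q)=(m_{a,b})_{1\leqslant a,b\leqslant n}$ is the $n\times n$ matrix over $\mathbb{F}_p$ with entries (binomial coefficients reduced modulo $p$, with $\binom{x}{y}=0$ for integers $0\leqslant x<y$) $$m_{a,b}=-\left[\binom{j+(n-a)(q-1)}{j+(n-b)(q-1)}+(-1)^{j+1}\binom{j+(n-a)(q-1)}{j+(b-1)(q-1)}\right]\ \text{ if } a\neq b,\qquad m_{a,a}=(-1)^{j+2}\binom{j+(n-a)(q-1)}{j+(a-1)(q-1)}.$$ $M(j,n,q,t)$ is the $n\times n$ matrix over $\mathbb{F}_q[t]$ whose $(a,b)$ entry is $m_{a,b}\,t^{\,j+1+(b-1)(q-1)}$. (It is the matrix of the Atkin operator $U_t$, normalized by a power of $t$, acting on a block of $\Gamma_0(t)$-invariant Drinfeld cusp forms of weight $k=2j+2+(n-1)(q-1)$.) *)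

theory Defs
  imports
    "HOL-Algebra.Algebraic_Closure_Type"
    "HOL-Analysis.Elementary_Topology"
    "HOL-Library.Cardinality"
    "HOL-Number_Theory.Prime_Powers"
    "Jordan_Normal_Form.Matrix"
begin

text \<open>
  \<open>'a\<close> is the finite field \<open>\<F>\<^sub>q\<close>, and \<open>'a fls\<close> is \<open>\<F>\<^sub>q((1/t))\<close>: the uniformizer \<open>fls_X\<close> is \<open>1/t\<close>,
  so \<open>t\<close> is \<open>fls_X_inv\<close>, and the absolute value of a nonzero \<open>f\<close> is \<open>q powi (- fls_subdegree f)\<close>,
  normalized by \<open>\<bar>t\<bar> = q\<close>.

  \<open>\<complex>\<^sub>\<infinity>\<close> is determined only up to isomorphism, so it enters as any field \<open>'c\<close> with a complete metric,
  induced by the absolute value \<open>\<lambda>x. dist x 0\<close>, together with a field embedding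
  of the algebraic closure of \<open>\<F>\<^sub>q((1/t))\<close> that has dense image and is compatible with the absolute
  value of \<open>\<F>\<^sub>q((1/t))\<close>. The absolute value on the algebraic closure is the one pulled back along
  the embedding; by completeness of \<open>\<F>\<^sub>q((1/t))\<close> it is the unique extension of that on \<open>\<F>\<^sub>q((1/t))\<close>.
\<close>

definition C_infinity ::
  "(('a :: {field, finite}) fls alg_closure \<Rightarrow> 'c :: {field, complete_space}) \<Rightarrow> bool" where
  "C_infinity emb \<longleftrightarrow>
     emb 1 = 1 \<and>
     (\<forall>x y. emb (x + y) = emb x + emb y) \<and>
     (\<forall>x y. emb (x * y) = emb x * emb y) \<and>
     (\<forall>u v :: 'c. dist u v = dist (u - v) 0) \<and>
     (\<forall>u v :: 'c. dist (u * v) 0 = dist u 0 * dist v 0) \<and>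
     (\<forall>f :: 'a fls. f \<noteq> 0 \<longrightarrow>
        dist (emb (to_ac f)) 0 = real CARD('a) powi (- fls_subdegree f)) \<and>
     closure (range emb) = UNIV"

text \<open>The inclusion \<open>\<F>\<^sub>q[t] \<subseteq> \<complex>\<^sub>\<infinity>\<close>; the inner \<open>poly\<close> evaluates at \<open>t = fls_X_inv\<close>.\<close>

definition poly_to_C ::
  "(('a :: {field, finite}) fls alg_closure \<Rightarrow> 'c :: {field, complete_space}) \<Rightarrow> 'a poly \<Rightarrow> 'c"
  where "poly_to_C emb f = emb (to_ac (poly (map_poly fls_const f) fls_X_inv))"

text \<open>
  The entry \<open>m\<^sub>a\<^sub>,\<^sub>b\<close> for \<open>1 \<le> a, b \<le> n\<close> (indices start at 1, so the subtractions do not truncate).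
  Over a ring of characteristic \<open>p\<close>, the map \<open>of_int\<close> is reduction modulo \<open>p\<close>.
\<close>

definition m_entry :: "nat \<Rightarrow> nat \<Rightarrow> nat \<Rightarrow> nat \<Rightarrow> nat \<Rightarrow> 'r :: comm_ring_1" where
  "m_entry j n q a b = of_int
    (if a \<noteq> b
     then - (int ((j + (n - a) * (q - 1)) choose (j + (n - b) * (q - 1)))
             + (-1) ^ (j + 1) * int ((j + (n - a) * (q - 1)) choose (j + (b - 1) * (q - 1))))
     else (-1) ^ (j + 2) * int ((j + (n - a) * (q - 1)) choose (j + (a - 1) * (q - 1))))"

text \<open>The matrix \<open>M(j,n,q,t)\<close>; matrix positions in the library start at 0, hence the shift.\<close>

definition M_t :: "nat \<Rightarrow> nat \<Rightarrow> nat \<Rightarrow> 'a :: comm_ring_1 poly mat" where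
  "M_t j n q = mat n n (\<lambda>(r, s).
     let a = r + 1; b = s + 1
     in Polynomial.monom (m_entry j n q a b) (j + 1 + (b - 1) * (q - 1)))"

definition diagonalizable :: "'c :: field mat \<Rightarrow> bool" where
  "diagonalizable A \<longleftrightarrow> (\<exists>D. diagonal_mat D \<and> similar_mat A D)"

end

theory Submission
  imports
    Defs
    "HOL-Number_Theory.Residues"
begin

text \<open>
  Since \<open>j + i (q - 1) = i q + (j - i)\<close> with \<open>0 \<le> i, j - i < q\<close>, Lucas' theorem turns every binomial
  coefficient in \<open>M(j,n,q)\<close> into a Kronecker delta, and \<open>M(j,n,q,t)\<close> is antidiagonal with
  \<open>M\<^sup>2 = t\<^sup>k\<close> for \<open>k = 2 (j + 1) + (n - 1) (q - 1)\<close>. If \<open>q\<close> is odd, then \<open>k\<close> is even and the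
  distinct values \<open>\<plusminus> t ^ (k div 2)\<close> have a basis of eigenvectors. If \<open>q\<close> is even, then
  all eigenvalues coincide, and a diagonalizable \<open>M\<close> would be scalar.
\<close>

section \<open>Binomial coefficients modulo p\<close>

text \<open>Absorption moves the factor \<open>p ^ e\<close> of the upper index onto
  \<open>l\<close> times the binomial coefficient; if the latter were prime to \<open>p\<close>, all
  of \<open>p ^ e\<close> would divide \<open>l\<close>.\<close>

lemma prime_dvd_binomial_power_mult:
  fixes p e i l :: nat
  assumes "prime p" and "\<not> p ^ e dvd l"
  shows "p dvd ((i * p ^ e) choose l)"
proof (rule ccontr)
  assume "\<not> ?thesis"
  then have coprime: "coprime (p ^ e) ((i * p ^ e) choose l)"
    using assms(1) by (simp add: prime_imp_coprime)
  have "l * ((i * p ^ e) choose l) = (i * p ^ e) * ((i * p ^ e - 1) choose (l - 1))"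
    using assms(2) times_binomial_minus1_eq[of l "i * p ^ e"] by (cases l) auto
  then have "p ^ e dvd l * ((i * p ^ e) choose l)"
    by simp
  with coprime have "p ^ e dvd l"
    by (simp add: coprime_dvd_mult_left_iff)
  with assms(2) show False ..
qed

text \<open>This is the vanishing case of Lucas: in base \<open>p ^ e\<close> the last digit
  \<open>j - k\<close> of the lower index exceeds the last digit \<open>j - i\<close> of the upper
  one. Vandermonde splits the upper index into these two digits, and every summand is divisible by
  \<open>p\<close> or zero.\<close>

lemma prime_dvd_binomial_block:
  fixes p e i j k :: nat
  assumes "prime p" and "k < i" and "i \<le> j" and "j < p ^ e"
  shows "p dvd ((j + i * (p ^ e - 1)) choose (j + k * (p ^ e - 1)))"
proof -
  define q where "q = p ^ e"
  have shift: "j + l * (q - 1) = l * q + (j - l)" if "l \<le> j" for l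
  proof -
    from assms(4) have "q = Suc (q - 1)"
      by (simp add: q_def)
    then have "l * q = l * (q - 1) + l"
      by (metis add.commute mult_Suc_right)
    with that show ?thesis by simp
  qed
  have "p dvd ((i * q) choose l) * ((j - i) choose (k * q + (j - k) - l))"
    if "l \<le> k * q + (j - k)" for l
  proof (cases "q dvd l")
    case False
    with assms(1) show ?thesis
      by (simp add: q_def prime_dvd_binomial_power_mult)
  next
    case True
    then obtain c where c: "l = c * q"
      by (metis dvd_def mult.commute)
    have "c * q < Suc k * q"
      using that assms(4) by (simp add: c q_def)
    then have "c \<le> k"
      by (metis less_Suc_eq_le mult_less_cancel2)
    then have "l \<le> k * q"
      by (simp add: c)
    \<comment> \<open>The second Vandermonde factor keeps a lower index of at least
      \<open>j - k\<close>, so it is zero.\<close>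
    then have "j - i < k * q + (j - k) - l"
      using assms(2,3) by linarith
    then show ?thesis by (simp add: binomial_eq_0)
  qed
  then have "p dvd (\<Sum>l\<le>k * q + (j - k).
      ((i * q) choose l) * ((j - i) choose (k * q + (j - k) - l)))"
    by (intro dvd_sum) auto
  also have "\<dots> = (i * q + (j - i)) choose (k * q + (j - k))"
    by (simp add: vandermonde)
  finally show ?thesis
    using assms(2,3) shift[of i] shift[of k] by (simp add: q_def)
qed

lemma CHAR_eq_prime_of_CARD:
  assumes "prime p" and "CARD('a :: {field, finite}) = p ^ e"
  shows "CHAR('a) = p"
proof -
  have "prime CHAR('a)"
    by (intro prime_CHAR_semidom finite_imp_CHAR_pos) simp
  moreover have "CHAR('a) dvd p ^ e"
    using CHAR_dvd_CARD[where 'a = 'a] assms(2) by simp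
  ultimately show ?thesis
    using assms(1) prime_dvd_power primes_dvd_imp_eq by blast
qed

lemma of_nat_binomial_block:
  fixes i j k q :: nat
  assumes "primepow q" and "CARD('a :: {field, finite}) = q"
    and "i \<le> j" and "k \<le> j" and "j < q"
  shows "(of_nat ((j + i * (q - 1)) choose (j + k * (q - 1))) :: 'a) = (if i = k then 1 else 0)"
proof -
  obtain p e where p: "prime p" and q: "q = p ^ e"
    using assms(1) by (auto simp: primepow_def)
  have char: "CHAR('a) = p"
    using CHAR_eq_prime_of_CARD[OF p] assms(2) q by simp
  consider "i = k" | "i < k" | "k < i" by linarith
  then show ?thesis
  proof cases
    case 2
    have "1 < q" using assms(1) by (simp add: primepow_gt_Suc_0)
    with 2 show ?thesis by (simp add: binomial_eq_0)
  next
    case 3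
    then have "p dvd ((j + i * (q - 1)) choose (j + k * (q - 1)))"
      unfolding q using p assms by (intro prime_dvd_binomial_block) (auto simp: q)
    with 3 show ?thesis by (simp add: of_nat_eq_0_iff_char_dvd char)
  qed simp
qed

text \<open>The bound \<open>n \<le> j + 1\<close> keeps all block indices at most \<open>j\<close>,
  so both binomials are Kronecker deltas. Off the diagonal only the second can survive, and the
  signs of both cases of \<open>m_entry\<close> reduce to \<open>(-1) ^ j\<close>.\<close>

lemma m_entry_antidiagonal:
  fixes a b j n q :: nat
  assumes "primepow q" and "CARD('a :: {field, finite}) = q"
    and "j < q" and "n \<le> j + 1" and "a \<in> {1..n}" and "b \<in> {1..n}"
  shows "(m_entry j n q a b :: 'a) = (if a + b = n + 1 then (-1) ^ j else 0)"
proof -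
  note block = of_nat_binomial_block[OF assms(1,2) _ _ assms(3)]
  have "n - a \<le> j" "n - b \<le> j" "a - 1 \<le> j" "b - 1 \<le> j"
    using assms(4-6) by auto
  moreover have "n - a = n - b \<longleftrightarrow> a = b" "n - a = b - 1 \<longleftrightarrow> a + b = n + 1"
    using assms(5,6) by auto
  ultimately show ?thesis
    by (cases "a = b") (auto simp: m_entry_def block power_add simp del: One_nat_def)
qed

section \<open>Matrices supported on the two diagonals\<close>

text \<open>
  Supported on the two diagonals of an \<open>n \<times> n\<close> matrix; where they meet (\<open>n\<close> odd, middle index)
  the entry is taken from \<open>d\<close> and \<open>u\<close> is ignored.
\<close>

definition cross_mat :: "nat \<Rightarrow> (nat \<Rightarrow> 'r) \<Rightarrow> (nat \<Rightarrow> 'r) \<Rightarrow> 'r :: semiring_1 mat" where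
  "cross_mat n d u =
     mat n n (\<lambda>(r, s). if r = s then d s else if Suc (r + s) = n then u s else 0)"

lemma cross_mat_carrier [simp]: "cross_mat n d u \<in> carrier_mat n n"
  by (simp add: cross_mat_def)

lemma cross_mat_cong:
  assumes "\<And>s. s < n \<Longrightarrow> d s = d' s"
    and "\<And>s. s < n \<Longrightarrow> Suc (s + s) \<noteq> n \<Longrightarrow> u s = u' s"
  shows "cross_mat n d u = cross_mat n d' u'"
  by (rule eq_matI) (auto simp: cross_mat_def assms)

lemma cross_mat_one: "cross_mat n (\<lambda>_. 1) (\<lambda>_. 0) = 1\<^sub>m n"
  by (rule eq_matI) (auto simp: cross_mat_def)

text \<open>Such matrices act blockwise on the pairs \<open>{s, n - Suc s}\<close>, so products
  reduce to 2 by 2 blocks, with a single entry in the middle. The conditional stops the middle entry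
  from being counted twice.\<close>

lemma cross_mat_mult:
  "cross_mat n d u * cross_mat n d' u' =
     cross_mat n (\<lambda>s. d s * d' s + (if Suc (s + s) = n then 0 else u (n - Suc s) * u' s))
       (\<lambda>s. u s * d' s + d (n - Suc s) * u' s)"
  (is "_ = ?R")
proof (rule eq_matI)
  fix r s
  assume "r < dim_row ?R" and "s < dim_col ?R"
  then have r: "r < n" and s: "s < n" by (simp_all add: cross_mat_def)
  define s' where "s' = n - Suc s"
  have s': "s' < n" "Suc (k + s) = n \<longleftrightarrow> k = s'" for k
    using s by (auto simp: s'_def)
  let ?X = "cross_mat n d u"
  have "(?X * cross_mat n d' u') $$ (r, s) =
      (\<Sum>k<n. ?X $$ (r, k) * (if k = s then d' s else if k = s' then u' s else 0))"
    using r s s' by (auto simp: cross_mat_def scalar_prod_def lessThan_atLeast0 intro!: sum.cong)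
  also have "\<dots> = (\<Sum>k<n. (if k = s then ?X $$ (r, s) * d' s else 0) +
      (if k = s' then (if s = s' then 0 else ?X $$ (r, s') * u' s) else 0))"
    by (intro sum.cong) auto
  also have "\<dots> = ?X $$ (r, s) * d' s + (if s = s' then 0 else ?X $$ (r, s') * u' s)"
    using s s' by (simp add: sum.distrib)
  finally show "(?X * cross_mat n d' u') $$ (r, s) = ?R $$ (r, s)"
    using r s s'(1) by (auto simp: cross_mat_def s'_def)
qed (simp_all add: cross_mat_def)

definition antidiag_mat :: "nat \<Rightarrow> (nat \<Rightarrow> 'r) \<Rightarrow> 'r :: semiring_1 mat" where
  "antidiag_mat n x = mat n n (\<lambda>(r, s). if Suc (r + s) = n then x s else 0)"

lemma antidiag_mat_eq_cross_mat:
  "antidiag_mat n x = cross_mat n (\<lambda>s. if Suc (s + s) = n then x s else 0) x"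
  by (rule eq_matI) (auto simp: antidiag_mat_def cross_mat_def)

lemma antidiag_mat_square:
  fixes x :: "nat \<Rightarrow> 'r :: comm_ring_1"
  assumes "\<And>s. s < n \<Longrightarrow> x (n - Suc s) * x s = c"
  shows "antidiag_mat n x * antidiag_mat n x = c \<cdot>\<^sub>m 1\<^sub>m n"
proof -
  have "antidiag_mat n x * antidiag_mat n x = cross_mat n (\<lambda>_. c) (\<lambda>_. 0)"
    unfolding antidiag_mat_eq_cross_mat cross_mat_mult
  proof (rule cross_mat_cong)
    fix s assume "s < n"
    with assms[OF this] show "(if Suc (s + s) = n then x s else 0) * (if Suc (s + s) = n then x s else 0) +
        (if Suc (s + s) = n then 0 else x (n - Suc s) * x s) = c"
      by (cases "Suc (s + s) = n") (auto simp: diff_Suc)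
  qed auto
  also have "\<dots> = c \<cdot>\<^sub>m 1\<^sub>m n"
    by (rule eq_matI) (auto simp: cross_mat_def)
  finally show ?thesis .
qed

text \<open>
  On each plane spanned by the unit vectors \<open>s\<close> and \<open>n - Suc s\<close>, the columns of \<open>P\<close> are
  eigenvectors for \<open>\<sigma>\<close> and \<open>- \<sigma>\<close>.
\<close>

lemma diagonalizable_antidiag_mat:
  fixes x :: "nat \<Rightarrow> 'c :: field"
  assumes x: "\<And>s. s < n \<Longrightarrow> x (n - Suc s) * x s = \<sigma>\<^sup>2"
    and "\<sigma> \<noteq> 0" and "(2 :: 'c) \<noteq> 0"
  shows "diagonalizable (antidiag_mat n x)"
proof -
  define \<tau> :: "nat \<Rightarrow> 'c" where "\<tau> s = (if Suc (s + s) \<le> n then 1 else -1)" for s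
  define P where "P = cross_mat n (\<lambda>_. \<sigma>) (\<lambda>s. \<tau> s * x s)"
  \<comment> \<open>Each 2 by 2 block of \<open>P\<close> has determinant
    \<open>2 * \<sigma>\<^sup>2\<close>, and \<open>Q\<close> collects the block inverses; the
    middle entry of \<open>P\<close> is just \<open>\<sigma>\<close>.\<close>
  define Q where "Q = cross_mat n (\<lambda>s. if Suc (s + s) = n then 1 / \<sigma> else 1 / (2 * \<sigma>))
    (\<lambda>s. - \<tau> s * x s / (2 * \<sigma>\<^sup>2))"
  \<comment> \<open>The middle entry is \<open>x s\<close> itself, since its sign as a square root
    of \<open>\<sigma>\<^sup>2\<close> is not known.\<close>
  define D where "D = cross_mat n (\<lambda>s. if Suc (s + s) = n then x s else \<tau> s * \<sigma>) (\<lambda>_. 0)"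
  let ?A = "antidiag_mat n x"
  have \<tau>_flip: "\<tau> (n - Suc s) = - \<tau> s" if "s < n" "Suc (s + s) \<noteq> n" for s
    using that by (auto simp: \<tau>_def)
  have \<tau>_square: "\<tau> s * \<tau> s = 1" for s
    by (simp add: \<tau>_def)
  have x\<tau>: "\<tau> s * x (n - Suc s) * (\<tau> s * x s) = \<sigma>\<^sup>2" if "s < n" for s
    using x[OF that] \<tau>_square[of s] by (simp add: \<tau>_def)
  have flip_mid: "Suc (n - Suc s + (n - Suc s)) = n \<longleftrightarrow> Suc (s + s) = n" if "s < n" for s
    using that by auto
  have PQ: "P * Q = 1\<^sub>m n"
    unfolding P_def Q_def cross_mat_mult cross_mat_one[symmetric]
    by (rule cross_mat_cong)
      (use assms(2,3) x\<tau> in \<open>auto simp: \<tau>_flip flip_mid field_simps power2_eq_square\<close>)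
  have QP: "Q * P = 1\<^sub>m n"
    unfolding P_def Q_def cross_mat_mult cross_mat_one[symmetric]
    by (rule cross_mat_cong)
      (use assms(2,3) x\<tau> in \<open>auto simp: \<tau>_flip flip_mid field_simps power2_eq_square\<close>)
  have AP: "?A * P = P * D"
    unfolding P_def D_def cross_mat_mult antidiag_mat_eq_cross_mat
    by (rule cross_mat_cong)
      (use x \<tau>_square in \<open>auto simp: flip_mid power2_eq_square\<close>)
  have carrier: "?A \<in> carrier_mat n n" "P \<in> carrier_mat n n" "Q \<in> carrier_mat n n" "D \<in> carrier_mat n n"
    by (simp_all add: antidiag_mat_eq_cross_mat P_def Q_def D_def)
  have "?A = ?A * (P * Q)"
    using carrier by (simp add: PQ)
  also have "\<dots> = P * D * Q"
    using carrier by (simp add: AP[symmetric])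
  finally have "similar_mat ?A D"
    using carrier PQ QP by (intro similar_matI[of _ _ P Q n]) auto
  moreover have "diagonal_mat D"
    by (simp add: diagonal_mat_def D_def cross_mat_def)
  ultimately show ?thesis
    unfolding diagonalizable_def by blast
qed

lemma conjugate_scalar:
  fixes P Q :: "'r :: comm_ring_1 mat"
  assumes P: "P \<in> carrier_mat n n" and Q: "Q \<in> carrier_mat n n" and PQ: "P * Q = 1\<^sub>m n"
  shows "P * (c \<cdot>\<^sub>m 1\<^sub>m n) * Q = c \<cdot>\<^sub>m 1\<^sub>m n"
proof -
  have "P * (c \<cdot>\<^sub>m 1\<^sub>m n) = c \<cdot>\<^sub>m P"
    using mult_smult_distrib[OF P one_carrier_mat] P by simp
  then show ?thesis
    using mult_smult_assoc_mat[OF P Q] PQ by simp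
qed

text \<open>In characteristic 2 an element has at most one square root, so the diagonal form is scalar.\<close>

lemma diagonalizable_square_scalar_char_2:
  fixes A :: "'c :: field mat"
  assumes two: "(2 :: 'c) = 0" and A: "A \<in> carrier_mat n n"
    and sq: "A * A = c \<cdot>\<^sub>m 1\<^sub>m n" and "diagonalizable A"
  obtains d where "A = d \<cdot>\<^sub>m 1\<^sub>m n"
proof -
  obtain D P Q where D: "diagonal_mat D" and wit: "similar_mat_wit A D P Q"
    using assms(4) unfolding diagonalizable_def similar_mat_def by blast
  note w = similar_mat_witD2[OF A wit]
  have "D = Q * A * P"
    using similar_mat_witD[OF _ similar_mat_wit_sym[OF wit]] by blast
  then have "D * D = Q * (A * A) * P"
    using similar_mat_wit_sym[OF wit] w A
    by (smt (verit) assoc_mult_mat left_mult_one_mat mult_carrier_mat)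
  also have "\<dots> = c \<cdot>\<^sub>m 1\<^sub>m n"
    using conjugate_scalar[OF w(7,6,2)] by (simp add: sq)
  finally have DD: "D * D = c \<cdot>\<^sub>m 1\<^sub>m n" .
  have root: "D $$ (i, i) * D $$ (i, i) = c" if "i < n" for i
  proof -
    have "(D * D) $$ (i, i) = (\<Sum>k<n. D $$ (i, k) * D $$ (k, i))"
      using that w by (simp add: scalar_prod_def lessThan_atLeast0)
    also have "\<dots> = (\<Sum>k<n. if k = i then D $$ (i, i) * D $$ (i, i) else 0)"
      using that w D by (intro sum.cong) (auto simp: diagonal_mat_def)
    finally show ?thesis
      using that DD by simp
  qed
  \<comment> \<open>For \<open>n = 0\<close> this value is arbitrary, but then there is no diagonal
    entry to compare with it.\<close>
  define d where "d = D $$ (0, 0)"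
  have "D $$ (i, i) = d" if "i < n" for i
  proof -
    let ?x = "D $$ (i, i)"
    have "(?x - d) * (?x - d) = ?x * ?x + d * d - 2 * (?x * d)"
      by (simp add: algebra_simps)
    also have "\<dots> = 2 * c"
      using root[of i] root[of 0] that two by (simp add: d_def)
    finally show ?thesis
      using two by simp
  qed
  with D w have "D = d \<cdot>\<^sub>m 1\<^sub>m n"
    by (intro eq_matI) (auto simp: diagonal_mat_def)
  then have "A = P * (d \<cdot>\<^sub>m 1\<^sub>m n) * Q"
    using w by metis
  also have "\<dots> = d \<cdot>\<^sub>m 1\<^sub>m n"
    using conjugate_scalar[OF w(6,7,1)] .
  finally show thesis by (rule that)
qed

section \<open>Passage to the complete field and the final equivalence\<close>

lemma C_infinity_hom:
  assumes "C_infinity emb"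
  shows "emb 0 = 0" and "emb 1 = 1" and "emb (x * y) = emb x * emb y"
    and "emb (x + y) = emb x + emb y" and "emb (- x) = - emb x" and "emb (x ^ m) = emb x ^ m"
    and "emb x = 0 \<longleftrightarrow> x = 0"
proof -
  have one: "emb 1 = 1" and mult: "\<And>x y. emb (x * y) = emb x * emb y"
    and add: "\<And>x y. emb (x + y) = emb x + emb y"
    using assms by (simp_all add: C_infinity_def)
  show zero: "emb 0 = 0"
    by (metis add add_0 add_cancel_right_right)
  show "emb (- x) = - emb x"
    using add[of x "- x"] zero by (simp add: eq_neg_iff_add_eq_0 add.commute)
  show "emb (x ^ m) = emb x ^ m"
    by (induction m) (simp_all add: one mult)
  show "emb x = 0 \<longleftrightarrow> x = 0"
    using mult[of x "inverse x"] one zero by (cases "x = 0") auto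
  show "emb 1 = 1" "emb (x * y) = emb x * emb y" "emb (x + y) = emb x + emb y"
    by (fact one mult add)+
qed

theorem corollary5p3:
  fixes emb :: "('a :: {field, finite}) fls alg_closure \<Rightarrow> 'c :: {field, complete_space}"
    and q j n :: nat
  assumes "primepow q" and "CARD('a) = q"
    and "C_infinity emb"
    and "j \<le> q - 2"
    and "2 \<le> n" and "n \<le> j + 1"
  shows "diagonalizable (map_mat (poly_to_C emb) (M_t j n q :: 'a poly mat)) \<longleftrightarrow> odd q"
proof -
  note hom = C_infinity_hom[OF assms(3)]
  \<comment> \<open>\<open>T\<close> is the image of t, and \<open>x s\<close> will be the only
    nonzero entry of column \<open>s\<close>.\<close>
  define T where "T = emb (to_ac fls_X_inv)"
  define x where "x s = (-1) ^ j * T ^ (j + 1 + s * (q - 1))" for s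
  let ?A = "map_mat (poly_to_C emb) (M_t j n q :: 'a poly mat)"
  have T: "T \<noteq> 0"
    by (simp add: T_def hom)
  have "j < q"
    using assms(4) primepow_gt_Suc_0[OF assms(1)] by linarith
  have poly_zero: "poly_to_C emb 0 = 0"
    by (simp add: poly_to_C_def hom)
  have poly_monom: "poly_to_C emb (Polynomial.monom ((-1) ^ j) e) = (-1) ^ j * T ^ e" for e
  proof -
    have "fls_const ((-1 :: 'a) ^ j) = (-1) ^ j"
      by (cases "even j") simp_all
    then show ?thesis
      by (simp add: poly_to_C_def map_poly_monom poly_monom hom T_def)
  qed
  have A: "?A = antidiag_mat n x"
    using m_entry_antidiagonal[OF assms(1,2) \<open>j < q\<close> assms(6)]
    by (intro eq_matI) (auto simp: M_t_def antidiag_mat_def poly_zero poly_monom x_def)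
  have x_mult: "x (n - Suc s) * x s = T ^ (2 * (j + 1) + (n - 1) * (q - 1))" if "s < n" for s
  proof -
    have "(n - Suc s) * (q - 1) + s * (q - 1) = (n - 1) * (q - 1)"
      using that by (simp flip: add_mult_distrib)
    then have "(j + 1 + (n - Suc s) * (q - 1)) + (j + 1 + s * (q - 1)) = 2 * (j + 1) + (n - 1) * (q - 1)"
      by simp
    moreover have "x (n - Suc s) * x s =
        ((-1) ^ j * (-1) ^ j) * T ^ ((j + 1 + (n - Suc s) * (q - 1)) + (j + 1 + s * (q - 1)))"
      unfolding x_def power_add by (simp add: mult_ac)
    ultimately show ?thesis
      by (simp only:) (simp flip: power_mult_distrib)
  qed
  obtain p e where p: "prime p" and q: "q = p ^ e" and "e > 0"
    using assms(1) by (auto simp: primepow_def)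
  have char: "CHAR('a) = p"
    using CHAR_eq_prime_of_CARD[OF p] assms(2) q by simp
  \<comment> \<open>Injectivity of the embeddings transfers the question whether 2 vanishes to the
    finite field.\<close>
  have "(2 :: 'c) = emb (to_ac (fls_const 2))"
    using hom(4)[of 1 1] by (simp add: hom(2))
  then have "(2 :: 'c) = 0 \<longleftrightarrow> (2 :: 'a) = 0"
    by (simp only: hom(7) to_ac_eq_0_iff fls_const_eq_0_iff)
  also have "\<dots> \<longleftrightarrow> p dvd 2"
    using of_nat_eq_0_iff_char_dvd[where 'a = 'a, of 2] char by simp
  also have "\<dots> \<longleftrightarrow> even p"
  proof
    assume "p dvd 2"
    then show "even p"
      using primes_dvd_imp_eq[OF p two_is_prime_nat] by simp
  next
    assume "even p"
    then show "p dvd 2"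
      using primes_dvd_imp_eq[OF two_is_prime_nat p] by simp
  qed
  also have "\<dots> \<longleftrightarrow> even q"
    using \<open>e > 0\<close> by (simp add: q)
  finally have two: "(2 :: 'c) = 0 \<longleftrightarrow> even q" .
  show ?thesis
  proof
    assume diag: "diagonalizable ?A"
    show "odd q"
    proof
      assume "even q"
      with two have "(2 :: 'c) = 0" by simp
      moreover have "?A \<in> carrier_mat n n"
        by (simp add: A antidiag_mat_def)
      moreover have "?A * ?A = T ^ (2 * (j + 1) + (n - 1) * (q - 1)) \<cdot>\<^sub>m 1\<^sub>m n"
        unfolding A by (rule antidiag_mat_square) (rule x_mult)
      ultimately obtain d where d: "?A = d \<cdot>\<^sub>m 1\<^sub>m n"
        using diag by (rule diagonalizable_square_scalar_char_2)
      \<comment> \<open>As \<open>n\<close> is at least 2, this corner lies off the main diagonal,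
        where a scalar matrix vanishes.\<close>
      have "x 0 = ?A $$ (n - 1, 0)"
        using assms(5) by (simp add: A antidiag_mat_def)
      also have "\<dots> = 0"
        using assms(5) unfolding d by simp
      finally show False
        using T by (simp add: x_def)
    qed
  next
    assume "odd q"
    \<comment> \<open>For odd \<open>q\<close> the number \<open>q - 1\<close> is even, so the
      exponent in \<open>x_mult\<close> can be halved.\<close>
    define \<sigma> where "\<sigma> = T ^ (j + 1 + (n - 1) * ((q - 1) div 2))"
    have "2 * (j + 1) + (n - 1) * (q - 1) = (j + 1 + (n - 1) * ((q - 1) div 2)) * 2"
      using \<open>odd q\<close> by (auto elim!: oddE)
    then have "x (n - Suc s) * x s = \<sigma>\<^sup>2" if "s < n" for s
      using x_mult[OF that] by (simp only: \<sigma>_def power_mult)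
    moreover have "\<sigma> \<noteq> 0"
      using T by (simp add: \<sigma>_def)
    ultimately show "diagonalizable ?A"
      unfolding A using two \<open>odd q\<close> by (intro diagonalizable_antidiag_mat) auto
  qed
qed

end
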